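(* Let $\mathcal{P}$ be an order-hereditary property of $k$-colourings with $\mathcal{P}_n\neq\emptyset$ for every $n\in\mathbb{N}$ and let $\varepsilon>0$ be fixed. There exists $n_0\in\mathbb{N}$ such that for all $n\ge n_0$, $$k^{\pi(\mathcal{P})\binom n2}\le|\mathcal{P}_n|\le k^{\pi(\mathcal{P})\binom n2+\varepsilon\binom n2}.$$
   Context: $k\ge2$ is a fixed integer and $[k]=\{1,\dots,k\}$. $K_n$ is the complete graph on vertex set $[n]$. A $k$-colouring of $K_n$ is a function $c:E(K_n)\to[k]$. For $A=\{a_1<\dots<a_m\}\subseteq[n]$ the restriction $c_{|A}$ is the $k$-colouring of $K_m$ given by $c_{|A}(ij)=c(a_ia_j)$. An order-hereditary property is a sequence $\mathcal{P}=(\mathcal{P}_n)_{n\in\mathbb{N}}$ where $\mathcal{P}_n$ is a set of $k$-colourings of $K_n$ and $c_{|A}\in\mathcal{P}_{|A|}$ whenever $c\in\mathcal{P}_n$ and $A\subseteq[n]$. A template for $K_n$ is a function $t$ assigning to each edge $e$ a nonempty set $t(e)\subseteq[k]$; $\langle t\rangle$ is the set of $k$-colourings $c$ of $K_n$ with $c(e)\in t(e)$ for all $e$; $\mathrm{Ent}(t)=\sum_{e}\log_k|t(e)|$. $\mathrm{ex}(n,\mathcal{P})=\max\{\mathrm{Ent}(t):\langle t\rangle\subseteq\mathcal{P}_n\}$ over templates $t$ for $K_n$, and $\pi(\mathcal{P})=\lim_{n\to\infty}\mathrm{ex}(n,\mathcal{P})/\binom n2$ (the limit exists). *)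

theory Defs
  imports Complex_Main "HOL-Library.FuncSet" "HOL-Library.Ramsey"
begin

text \<open>
  The edges of the complete graph on \<open>{1..n}\<close> are the two-element sets \<open>nsets {1..n} 2\<close>.
  Colourings and templates are extensional functions on the edge set (\<open>undefined\<close> elsewhere),
  so that the cardinality of a set of colourings is the intended one.
\<close>

definition colourings :: "nat \<Rightarrow> nat \<Rightarrow> (nat set \<Rightarrow> nat) set" where
  "colourings k n = nsets {1..n} 2 \<rightarrow>\<^sub>E {1..k}"

text \<open>
  The list \<open>sorted_list_of_set A\<close> is the increasing enumeration of \<open>A\<close>; it is indexed from \<open>0\<close>,
  hence the shift by one.
\<close>

definition restriction :: "(nat set \<Rightarrow> nat) \<Rightarrow> nat set \<Rightarrow> (nat set \<Rightarrow> nat)" where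
  "restriction c A =
     (\<lambda>e \<in> nsets {1..card A} 2. c ((\<lambda>i. sorted_list_of_set A ! (i - 1)) ` e))"

definition order_hereditary :: "nat \<Rightarrow> (nat \<Rightarrow> (nat set \<Rightarrow> nat) set) \<Rightarrow> bool" where
  "order_hereditary k P \<longleftrightarrow>
     (\<forall>n. P n \<subseteq> colourings k n) \<and>
     (\<forall>n. \<forall>c \<in> P n. \<forall>A \<subseteq> {1..n}. restriction c A \<in> P (card A))"

definition templates :: "nat \<Rightarrow> nat \<Rightarrow> (nat set \<Rightarrow> nat set) set" where
  "templates k n = nsets {1..n} 2 \<rightarrow>\<^sub>E (Pow {1..k} - {{}})"

definition realisations :: "nat \<Rightarrow> nat \<Rightarrow> (nat set \<Rightarrow> nat set) \<Rightarrow> (nat set \<Rightarrow> nat) set" where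
  "realisations k n t = {c \<in> colourings k n. \<forall>e \<in> nsets {1..n} 2. c e \<in> t e}"

definition entropy :: "nat \<Rightarrow> nat \<Rightarrow> (nat set \<Rightarrow> nat set) \<Rightarrow> real" where
  "entropy k n t = (\<Sum>e \<in> nsets {1..n} 2. log (real k) (real (card (t e))))"

text \<open>
  The maximum is over a finite set, which is nonempty whenever \<open>P n\<close> is a nonempty set of
  colourings.
\<close>

definition extremal_entropy :: "nat \<Rightarrow> nat \<Rightarrow> (nat \<Rightarrow> (nat set \<Rightarrow> nat) set) \<Rightarrow> real" where
  "extremal_entropy k n P =
     Max {entropy k n t |t. t \<in> templates k n \<and> realisations k n t \<subseteq> P n}"

definition entropy_density :: "nat \<Rightarrow> (nat \<Rightarrow> (nat set \<Rightarrow> nat) set) \<Rightarrow> real" where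
  "entropy_density k P = lim (\<lambda>n. extremal_entropy k n P / real (n choose 2))"

end

theory Submission
  imports Defs
begin

text \<open>
  The lower bound holds for every \<open>n \<ge> 2\<close>, because \<open>ex(n, P) / (n choose 2)\<close> is nonincreasing, hence
  at least its limit. For the upper bound, let \<open>c\<close> be uniform in \<open>P n\<close>. A suitable vertex set \<open>S\<close> of
  bounded size has the property that revealing the colours of all edges touching \<open>S\<close> costs only
  \<open>O(n)\<close> entropy, while additionally revealing all edges that touch some bounded set \<open>B\<close> lowers the
  average conditional entropy of a single edge very little. For a typical \<open>N\<close>-set \<open>A\<close>, every edge of
  \<open>A\<close> other than \<open>e\<close> touches \<open>A - e\<close>, so conditionally on the revealed colours the edges of \<open>A\<close> are
  nearly independent. Hence every combination of colours that are not too unlikely on the edges of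
  \<open>A\<close> occurs in \<open>P n\<close>. These colours form a template whose entropy is nearly that of \<open>c\<close> on \<open>A\<close>,
  and this is at most \<open>ex(N, P)\<close>.
\<close>

section \<open>Entropy of a function on a finite uniform space\<close>

definition freq :: "'a set \<Rightarrow> ('a \<Rightarrow> 'b) \<Rightarrow> 'b \<Rightarrow> real" where
  "freq \<Omega> f a = card {\<omega> \<in> \<Omega>. f \<omega> = a} / card \<Omega>"

text \<open>Shannon entropy in nats for a uniform point of \<open>\<Omega>\<close>. Averaging over
  points instead of summing over values names no range set and, for finite \<open>\<Omega>\<close>,
  meets only positive frequencies.\<close>

definition ent :: "'a set \<Rightarrow> ('a \<Rightarrow> 'b) \<Rightarrow> real" where
  "ent \<Omega> f = - (\<Sum>\<omega>\<in>\<Omega>. ln (freq \<Omega> f (f \<omega>))) / card \<Omega>"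

lemma freq_nonneg: "0 \<le> freq \<Omega> f a"
  by (simp add: freq_def)

lemma freq_le_1: "finite \<Omega> \<Longrightarrow> freq \<Omega> f a \<le> 1"
  by (auto simp: freq_def intro!: divide_le_eq_1[THEN iffD2] card_mono)

lemma freq_pos: "finite \<Omega> \<Longrightarrow> \<omega> \<in> \<Omega> \<Longrightarrow> 0 < freq \<Omega> f (f \<omega>)"
  by (auto simp: freq_def card_gt_0_iff intro!: divide_pos_pos)

lemma freq_eq_0: "a \<notin> f ` \<Omega> \<Longrightarrow> freq \<Omega> f a = 0"
  by (auto simp: freq_def intro: card_eq_0_iff[THEN iffD2])

lemma average_eq_sum_freq:
  fixes g :: "'b \<Rightarrow> real"
  assumes "finite \<Omega>" "finite T" "f ` \<Omega> \<subseteq> T"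
  shows "(\<Sum>\<omega>\<in>\<Omega>. g (f \<omega>)) / card \<Omega> = (\<Sum>a\<in>T. freq \<Omega> f a * g a)"
  using sum_fun_comp[OF assms, of g]
  by (simp add: freq_def sum_divide_distrib)

lemma sum_freq:
  assumes "finite \<Omega>" "\<Omega> \<noteq> {}" "finite T" "f ` \<Omega> \<subseteq> T"
  shows "(\<Sum>a\<in>T. freq \<Omega> f a) = 1"
  using average_eq_sum_freq[OF assms(1,3,4), of "\<lambda>_. 1"] assms(1,2) by simp

lemma ent_nonneg: "finite \<Omega> \<Longrightarrow> 0 \<le> ent \<Omega> f"
  unfolding ent_def
  by (intro divide_nonneg_nonneg) (auto simp: sum_nonpos ln_le_zero_iff freq_pos freq_le_1)

text \<open>Entropy sees only the partition into fibres, so differently encoded versions of the same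
  information may be exchanged, even across types.\<close>

lemma ent_cong:
  assumes "\<And>\<omega> \<omega>'. \<omega> \<in> \<Omega> \<Longrightarrow> \<omega>' \<in> \<Omega> \<Longrightarrow> f \<omega> = f \<omega>' \<longleftrightarrow> g \<omega> = g \<omega>'"
  shows "ent \<Omega> f = ent \<Omega> g"
proof -
  have "freq \<Omega> f (f \<omega>) = freq \<Omega> g (g \<omega>)" if "\<omega> \<in> \<Omega>" for \<omega>
    using assms that by (auto simp: freq_def intro!: arg_cong[where f = card])
  then show ?thesis by (simp add: ent_def)
qed

lemma ent_eq_sum:
  assumes "finite \<Omega>" "finite T" "f ` \<Omega> \<subseteq> T"
  shows "ent \<Omega> f = - (\<Sum>a\<in>T. freq \<Omega> f a * ln (freq \<Omega> f a))"
  using average_eq_sum_freq[OF assms, of "\<lambda>a. ln (freq \<Omega> f a)"] by (simp add: ent_def)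

lemma ent_inj_on:
  assumes "finite \<Omega>" "inj_on f \<Omega>"
  shows "ent \<Omega> f = ln (card \<Omega>)"
proof -
  have "{\<omega>' \<in> \<Omega>. f \<omega>' = f \<omega>} = {\<omega>}" if "\<omega> \<in> \<Omega>" for \<omega>
    using assms that by (auto dest: inj_onD)
  then have "freq \<Omega> f (f \<omega>) = 1 / card \<Omega>" if "\<omega> \<in> \<Omega>" for \<omega>
    using that by (simp add: freq_def)
  then show ?thesis by (simp add: ent_def ln_div)
qed

text \<open>The values in \<open>T\<close> are compared with the uniform distribution on
  \<open>T\<close>, at the price of the mass missing from \<open>T\<close>, at most
  \<open>card K * \<delta>\<close>. Each rare value adds at most \<open>2 * sqrt \<delta>\<close>.
  Together these make up the factor 3.\<close>

lemma ent_le_ln_card_frequent: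
  assumes fin: "finite \<Omega>" "\<Omega> \<noteq> {}" "finite K" and im: "f ` \<Omega> \<subseteq> K"
    and T: "T \<subseteq> K" "T \<noteq> {}" and rare: "\<And>a. a \<in> K - T \<Longrightarrow> freq \<Omega> f a \<le> \<delta>"
    and \<delta>: "0 \<le> \<delta>" "\<delta> \<le> 1"
  shows "ent \<Omega> f \<le> ln (card T) + 3 * card K * sqrt \<delta>"
proof -
  let ?p = "freq \<Omega> f"
  have finT: "finite T" using T fin finite_subset by blast
  have cT: "1 \<le> real (card T)" using T finT by (simp add: Suc_le_eq card_gt_0_iff)
  have sum1: "(\<Sum>a\<in>T. ?p a) + (\<Sum>a\<in>K-T. ?p a) = 1"
    using sum_freq[OF fin im] sum.subset_diff[OF T(1) fin(3), of ?p] by simp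
  have "(\<Sum>a\<in>K-T. ?p a) \<le> (\<Sum>a\<in>K-T. \<delta>)"
    by (intro sum_mono rare)
  also have "\<dots> \<le> card K * \<delta>"
    using \<delta> fin by (auto intro!: mult_right_mono card_mono)
  finally have small: "(\<Sum>a\<in>K-T. ?p a) \<le> card K * \<delta>" .
  have A: "- (?p a * ln (?p a)) \<le> ?p a * ln (card T) + (1 / card T - ?p a)" for a
  proof (cases "?p a = 0")
    case False
    then have p: "0 < ?p a" using freq_nonneg[of \<Omega> f a] by linarith
    have "ln (1 / (card T * ?p a)) \<le> 1 / (card T * ?p a) - 1"
      using p cT by (intro ln_le_minus_one) auto
    then have "?p a * ln (1 / (card T * ?p a)) \<le> ?p a * (1 / (card T * ?p a) - 1)"
      using p by (intro mult_left_mono) auto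
    also have "\<dots> = 1 / card T - ?p a" using p cT by (simp add: field_simps)
    also have "ln (1 / (card T * ?p a)) = - ln (card T) - ln (?p a)"
      using p cT by (simp add: ln_div ln_mult)
    finally show ?thesis by (simp add: algebra_simps)
  qed simp
  \<comment> \<open>Applying \<open>ln x \<le> x - 1\<close> to \<open>1 / sqrt p\<close> instead of
    \<open>1 / p\<close> makes the bound tend to 0 with \<open>p\<close>.\<close>
  have B: "- (?p a * ln (?p a)) \<le> 2 * sqrt \<delta>" if "a \<in> K - T" for a
  proof (cases "?p a = 0")
    case False
    then have p: "0 < ?p a" using freq_nonneg[of \<Omega> f a] by linarith
    have "ln (1 / sqrt (?p a)) \<le> 1 / sqrt (?p a) - 1"
      using p by (intro ln_le_minus_one) auto
    moreover have "ln (1 / sqrt (?p a)) = - ln (?p a) / 2"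
      using p by (simp add: ln_div ln_sqrt)
    ultimately have "- ln (?p a) \<le> 2 / sqrt (?p a)" by simp
    then have "?p a * (- ln (?p a)) \<le> ?p a * (2 / sqrt (?p a))"
      using p by (intro mult_left_mono) auto
    also have "\<dots> = 2 * sqrt (?p a)" using p by (simp add: real_div_sqrt field_simps)
    also have "\<dots> \<le> 2 * sqrt \<delta>" using rare[OF that] by simp
    finally show ?thesis by simp
  qed (use \<delta> in simp)
  have "ent \<Omega> f = (\<Sum>a\<in>T. - (?p a * ln (?p a))) + (\<Sum>a\<in>K-T. - (?p a * ln (?p a)))"
    using ent_eq_sum[OF fin(1,3) im] sum.subset_diff[OF T(1) fin(3), of "\<lambda>a. ?p a * ln (?p a)"]
    by (simp add: sum_negf)
  also have "\<dots> \<le> (\<Sum>a\<in>T. ?p a * ln (card T) + (1 / card T - ?p a)) + (\<Sum>a\<in>K-T. 2 * sqrt \<delta>)"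
    by (intro add_mono sum_mono A B)
  also have "(\<Sum>a\<in>T. ?p a * ln (card T) + (1 / card T - ?p a)) =
      (\<Sum>a\<in>T. ?p a) * ln (card T) + (1 - (\<Sum>a\<in>T. ?p a))"
    using cT T finT by (simp add: sum.distrib sum_subtractf sum_distrib_right)
  also have "\<dots> \<le> 1 * ln (card T) + card K * \<delta>"
    using sum1 small cT sum_nonneg[of "K - T" ?p, OF freq_nonneg]
    by (intro add_mono mult_right_mono) auto
  also have "(\<Sum>a\<in>K-T. 2 * sqrt \<delta>) \<le> card K * (2 * sqrt \<delta>)"
    using \<delta> fin by (auto intro!: mult_right_mono card_mono)
  also have "\<delta> \<le> sqrt \<delta>" using \<delta> by (simp add: real_le_rsqrt power2_eq_square mult_left_le)
  then have "card K * \<delta> \<le> card K * sqrt \<delta>" by (intro mult_left_mono) auto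
  finally show ?thesis by (simp add: algebra_simps)
qed

lemma ent_le_ln_card:
  assumes "finite \<Omega>" "\<Omega> \<noteq> {}" "finite K" "f ` \<Omega> \<subseteq> K"
  shows "ent \<Omega> f \<le> ln (card K)"
  using ent_le_ln_card_frequent[OF assms order_refl, of 0] assms by auto

text \<open>Subadditivity with a gain. The gap between the two entropies is the relative entropy of
  the joint law with respect to the product of the marginals. By \<open>ln x \<le> x - 1\<close> it
  is at least the product mass of any set \<open>Z\<close> of tuples that never occur;
  \<open>Z = {}\<close> gives plain subadditivity.\<close>

lemma ent_tuple_le:
  assumes fin: "finite \<Omega>" "\<Omega> \<noteq> {}" "finite I"
    and Z: "Z \<subseteq> (\<Pi>\<^sub>E i\<in>I. X i ` \<Omega>)" "Z \<inter> (\<lambda>\<omega>. \<lambda>i\<in>I. X i \<omega>) ` \<Omega> = {}"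
  shows "ent \<Omega> (\<lambda>\<omega>. \<lambda>i\<in>I. X i \<omega>) + (\<Sum>x\<in>Z. \<Prod>i\<in>I. freq \<Omega> (X i) (x i)) \<le> (\<Sum>i\<in>I. ent \<Omega> (X i))"
proof -
  define J where "J = (\<lambda>\<omega>. \<lambda>i\<in>I. X i \<omega>)"
  define \<nu> where "\<nu> = (\<lambda>x. \<Prod>i\<in>I. freq \<Omega> (X i) (x i))"
  let ?n = "real (card \<Omega>)" and ?U = "\<Pi>\<^sub>E i\<in>I. X i ` \<Omega>"
  have n: "0 < ?n" using fin by (simp add: card_gt_0_iff)
  have J: "J ` \<Omega> \<subseteq> ?U" by (auto simp: J_def)
  have finU: "finite ?U" using fin by (intro finite_PiE) auto
  have pos: "0 < \<nu> (J \<omega>)" "0 < freq \<Omega> J (J \<omega>)" if "\<omega> \<in> \<Omega>" for \<omega>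
    using that fin(1) by (auto simp: \<nu>_def J_def intro!: prod_pos freq_pos)
  have "(\<Sum>x\<in>?U. \<nu> x) = (\<Prod>i\<in>I. \<Sum>a\<in>X i ` \<Omega>. freq \<Omega> (X i) a)"
    unfolding \<nu>_def using fin by (intro prod_sum_PiE[symmetric]) auto
  also have "\<dots> = 1" using fin by (intro prod.neutral) (simp add: sum_freq)
  finally have \<nu>1: "(\<Sum>x\<in>?U. \<nu> x) = 1" .
  have "ent \<Omega> J - (\<Sum>i\<in>I. ent \<Omega> (X i)) =
      (\<Sum>\<omega>\<in>\<Omega>. (\<Sum>i\<in>I. ln (freq \<Omega> (X i) (X i \<omega>))) - ln (freq \<Omega> J (J \<omega>))) / ?n"
    by (simp add: ent_def sum_subtractf sum_negf diff_divide_distrib sum.swap[of _ I \<Omega>]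
        flip: sum_divide_distrib)
  also have "\<dots> = (\<Sum>\<omega>\<in>\<Omega>. ln (\<nu> (J \<omega>) / freq \<Omega> J (J \<omega>))) / ?n"
  proof -
    have "(\<Sum>i\<in>I. ln (freq \<Omega> (X i) (X i \<omega>))) = ln (\<nu> (J \<omega>))" if "\<omega> \<in> \<Omega>" for \<omega>
      unfolding \<nu>_def using fin less_imp_neq[OF freq_pos[OF fin(1) that], symmetric]
      by (subst ln_prod) (auto simp: J_def)
    then show ?thesis using pos by (simp add: ln_div less_imp_neq[symmetric] cong: sum.cong)
  qed
  also have "\<dots> \<le> (\<Sum>\<omega>\<in>\<Omega>. \<nu> (J \<omega>) / freq \<Omega> J (J \<omega>) - 1) / ?n"
    using n pos by (intro divide_right_mono sum_mono ln_le_minus_one) auto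
  also have "\<dots> = (\<Sum>\<omega>\<in>\<Omega>. \<nu> (J \<omega>) / freq \<Omega> J (J \<omega>)) / ?n - 1"
    using n by (simp add: sum_subtractf diff_divide_distrib)
  \<comment> \<open>Averaging the density ratio returns the product mass of the attained tuples
    only, and this leaves room for the mass of \<open>Z\<close>.\<close>
  also have "(\<Sum>\<omega>\<in>\<Omega>. \<nu> (J \<omega>) / freq \<Omega> J (J \<omega>)) / ?n = (\<Sum>x\<in>J ` \<Omega>. \<nu> x)"
    using pos(2) by (subst average_eq_sum_freq[where T = "J ` \<Omega>" and f = J])
      (auto simp: fin less_imp_neq[symmetric] intro!: sum.cong)
  also have "\<dots> + (\<Sum>x\<in>Z. \<nu> x) = (\<Sum>x\<in>J ` \<Omega> \<union> Z. \<nu> x)"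
    using Z finU fin by (intro sum.union_disjoint[symmetric]) (auto simp: J_def intro: finite_subset)
  then have "(\<Sum>x\<in>J ` \<Omega>. \<nu> x) = (\<Sum>x\<in>J ` \<Omega> \<union> Z. \<nu> x) - (\<Sum>x\<in>Z. \<nu> x)" by simp
  also have "(\<Sum>x\<in>J ` \<Omega> \<union> Z. \<nu> x) \<le> (\<Sum>x\<in>?U. \<nu> x)"
    using J Z finU by (intro sum_mono2) (auto simp: \<nu>_def intro!: prod_nonneg freq_nonneg)
  finally show ?thesis using \<nu>1 unfolding J_def \<nu>_def by linarith
qed

lemma ent_pair_le:
  fixes f g :: "'a \<Rightarrow> 'b"
  assumes "finite \<Omega>" "\<Omega> \<noteq> {}"
  shows "ent \<Omega> (\<lambda>\<omega>. (f \<omega>, g \<omega>)) \<le> ent \<Omega> f + ent \<Omega> g"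
proof -
  \<comment> \<open>A pair is coded as a tuple indexed by the booleans, which is why
    \<open>f\<close> and \<open>g\<close> share a codomain.\<close>
  have "ent \<Omega> (\<lambda>\<omega>. (f \<omega>, g \<omega>)) = ent \<Omega> (\<lambda>\<omega>. \<lambda>b\<in>UNIV. if b then f \<omega> else g \<omega>)"
    by (intro ent_cong) (auto simp: fun_eq_iff all_bool_eq)
  also have "\<dots> \<le> (\<Sum>b\<in>UNIV. ent \<Omega> (\<lambda>\<omega>. if b then f \<omega> else g \<omega>))"
    using ent_tuple_le[OF assms, of UNIV "{}" "\<lambda>b \<omega>. if b then f \<omega> else g \<omega>"] by simp
  finally show ?thesis by (simp add: UNIV_bool)
qed

text \<open>The left side is the conditional entropy of \<open>f\<close> given \<open>g\<close>. A
  uniform point conditioned on its \<open>g\<close>-value is uniform on a cell of \<open>g\<close>,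
  so this is an average of ordinary entropies over cells.\<close>

lemma ent_chain:
  assumes fin: "finite \<Omega>" "\<Omega> \<noteq> {}"
  shows "ent \<Omega> (\<lambda>\<omega>. (f \<omega>, g \<omega>)) - ent \<Omega> g =
    (\<Sum>\<omega>\<in>\<Omega>. ent {\<omega>' \<in> \<Omega>. g \<omega>' = g \<omega>} f) / card \<Omega>"
proof -
  define C where "C b = {\<omega> \<in> \<Omega>. g \<omega> = b}" for b
  have C: "finite (C b)" for b using fin by (simp add: C_def)
  have freq_C: "freq (C (g \<omega>)) f (f \<omega>) = freq \<Omega> (\<lambda>\<omega>. (f \<omega>, g \<omega>)) (f \<omega>, g \<omega>) / freq \<Omega> g (g \<omega>)"
    if "\<omega> \<in> \<Omega>" for \<omega>
  proof -
    have "{\<omega>' \<in> C (g \<omega>). f \<omega>' = f \<omega>} = {\<omega>' \<in> \<Omega>. (f \<omega>', g \<omega>') = (f \<omega>, g \<omega>)}"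
      by (auto simp: C_def)
    then show ?thesis using fin that by (simp add: freq_def C_def)
  qed
  have "(\<Sum>\<omega>\<in>\<Omega>. ent (C (g \<omega>)) f) = (\<Sum>b\<in>g ` \<Omega>. card (C b) * ent (C b) f)"
    unfolding C_def using fin by (intro sum_fun_comp) auto
  also have "\<dots> = (\<Sum>b\<in>g ` \<Omega>. \<Sum>\<omega>\<in>C b. - ln (freq (C (g \<omega>)) f (f \<omega>)))"
    using C by (intro sum.cong) (auto simp: ent_def sum_negf card_gt_0_iff C_def)
  also have "\<dots> = (\<Sum>\<omega>\<in>\<Omega>. - ln (freq (C (g \<omega>)) f (f \<omega>)))"
    unfolding C_def using fin by (intro sum.group) auto
  also have "\<dots> = (\<Sum>\<omega>\<in>\<Omega>. ln (freq \<Omega> g (g \<omega>)) - ln (freq \<Omega> (\<lambda>\<omega>. (f \<omega>, g \<omega>)) (f \<omega>, g \<omega>)))"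
    using freq_pos[OF fin(1), of _ g] freq_pos[OF fin(1), of _ "\<lambda>\<omega>. (f \<omega>, g \<omega>)"]
    by (intro sum.cong) (simp_all add: freq_C ln_div less_imp_neq[symmetric])
  finally show ?thesis
    by (simp add: C_def ent_def sum_subtractf diff_divide_distrib)
qed

lemma ent_mono:
  assumes "finite \<Omega>" "\<Omega> \<noteq> {}"
  shows "ent \<Omega> g \<le> ent \<Omega> (\<lambda>\<omega>. (f \<omega>, g \<omega>))"
proof -
  have "0 \<le> (\<Sum>\<omega>\<in>\<Omega>. ent {\<omega>' \<in> \<Omega>. g \<omega>' = g \<omega>} f) / card \<Omega>"
    using assms by (intro divide_nonneg_nonneg sum_nonneg ent_nonneg) auto
  then show ?thesis using ent_chain[OF assms, of f g] by simp
qed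

text \<open>Subadditivity inside each cell of \<open>g\<close>, averaged over the cells by the chain
  rule.\<close>

lemma ent_submodular:
  fixes f h :: "'a \<Rightarrow> 'b"
  assumes fin: "finite \<Omega>" "\<Omega> \<noteq> {}"
  shows "ent \<Omega> (\<lambda>\<omega>. (f \<omega>, h \<omega>, g \<omega>)) + ent \<Omega> g \<le>
    ent \<Omega> (\<lambda>\<omega>. (f \<omega>, g \<omega>)) + ent \<Omega> (\<lambda>\<omega>. (h \<omega>, g \<omega>))"
proof -
  let ?C = "\<lambda>\<omega>. {\<omega>' \<in> \<Omega>. g \<omega>' = g \<omega>}"
  have "(\<Sum>\<omega>\<in>\<Omega>. ent (?C \<omega>) (\<lambda>\<omega>. (f \<omega>, h \<omega>))) \<le> (\<Sum>\<omega>\<in>\<Omega>. ent (?C \<omega>) f + ent (?C \<omega>) h)"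
    using fin by (intro sum_mono ent_pair_le) auto
  then have "(\<Sum>\<omega>\<in>\<Omega>. ent (?C \<omega>) (\<lambda>\<omega>. (f \<omega>, h \<omega>))) / card \<Omega> \<le>
      (\<Sum>\<omega>\<in>\<Omega>. ent (?C \<omega>) f) / card \<Omega> + (\<Sum>\<omega>\<in>\<Omega>. ent (?C \<omega>) h) / card \<Omega>"
    by (simp add: sum.distrib divide_right_mono flip: add_divide_distrib)
  then have "ent \<Omega> (\<lambda>\<omega>. ((f \<omega>, h \<omega>), g \<omega>)) + ent \<Omega> g \<le>
      ent \<Omega> (\<lambda>\<omega>. (f \<omega>, g \<omega>)) + ent \<Omega> (\<lambda>\<omega>. (h \<omega>, g \<omega>))"
    by (simp flip: ent_chain[OF fin])
  moreover have "ent \<Omega> (\<lambda>\<omega>. ((f \<omega>, h \<omega>), g \<omega>)) = ent \<Omega> (\<lambda>\<omega>. (f \<omega>, h \<omega>, g \<omega>))"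
    by (rule ent_cong) auto
  ultimately show ?thesis by simp
qed

section \<open>Extremal entropy\<close>

declare finite_imp_finite_nsets [simp]

section \<open>Double counting of edges and vertex sets\<close>

lemma card_nsets:
  assumes "finite A"
  shows "card (nsets A k) = card A choose k"
proof -
  have "nsets A k = {B. B \<subseteq> A \<and> card B = k}"
    using assms by (auto simp: nsets_def intro: finite_subset)
  then show ?thesis using n_subsets[OF assms] by simp
qed

text \<open>The bijection \<open>(A, e) \<mapsto> (A - e, e)\<close>, with inverse
  \<open>(B, e) \<mapsto> (B \<union> e, e)\<close>. It turns a sum in which the revealed set
  depends on the edge into sums with a fixed revealed set \<open>B\<close>.\<close>

lemma sum_nsets_edges_complement:
  fixes \<phi> :: "'a set \<Rightarrow> 'a set \<Rightarrow> real"
  assumes "finite M" "2 \<le> N"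
  shows "(\<Sum>A\<in>nsets M N. \<Sum>e\<in>nsets A 2. \<phi> e (A - e)) =
    (\<Sum>B\<in>nsets M (N - 2). \<Sum>e\<in>nsets (M - B) 2. \<phi> e B)"
proof -
  have fin: "finite A" if "A \<subseteq> M" for A using assms that finite_subset by blast
  have "(\<Sum>(A, e)\<in>Sigma (nsets M N) (\<lambda>A. nsets A 2). \<phi> e (A - e)) =
    (\<Sum>(B, e)\<in>Sigma (nsets M (N - 2)) (\<lambda>B. nsets (M - B) 2). \<phi> e B)"
  proof (rule sum.reindex_bij_witness[where j = "\<lambda>(A, e). (A - e, e)" and i = "\<lambda>(B, e). (B \<union> e, e)"])
    fix p assume "p \<in> Sigma (nsets M N) (\<lambda>A. nsets A 2)"
    then show "(case case p of (A, e) \<Rightarrow> (A - e, e) of (B, e) \<Rightarrow> (B \<union> e, e)) = p"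
      "(case p of (A, e) \<Rightarrow> (A - e, e)) \<in> Sigma (nsets M (N - 2)) (\<lambda>B. nsets (M - B) 2)"
      "(case case p of (A, e) \<Rightarrow> (A - e, e) of (B, e) \<Rightarrow> \<phi> e B) = (case p of (A, e) \<Rightarrow> \<phi> e (A - e))"
      by (auto simp: nsets_def card_Diff_subset)
  next
    fix p assume p: "p \<in> Sigma (nsets M (N - 2)) (\<lambda>B. nsets (M - B) 2)"
    then show "(case case p of (B, e) \<Rightarrow> (B \<union> e, e) of (A, e) \<Rightarrow> (A - e, e)) = p"
      by (auto simp: nsets_def)
    show "(case p of (B, e) \<Rightarrow> (B \<union> e, e)) \<in> Sigma (nsets M N) (\<lambda>A. nsets A 2)"
    proof -
      obtain B e where Be: "p = (B, e)" "B \<subseteq> M" "finite B" "card B = N - 2" "e \<subseteq> M - B" "finite e" "card e = 2"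
        using p by (auto simp: nsets_def)
      then have "card (B \<union> e) = N"
        using assms(2) by (subst card_Un_disjoint) auto
      then show ?thesis using Be by (auto simp: nsets_def)
    qed
  qed
  then show ?thesis
    using assms by (subst (asm) (1 2) sum.Sigma[symmetric]) (auto simp: nsets_def fin)
qed

lemma sum_nsets_edges:
  fixes \<phi> :: "'a set \<Rightarrow> real"
  assumes "finite M" "2 \<le> N"
  shows "(\<Sum>A\<in>nsets M N. \<Sum>e\<in>nsets A 2. \<phi> e) =
    ((card M - 2) choose (N - 2)) * (\<Sum>e\<in>nsets M 2. \<phi> e)"
proof -
  have sets: "{e \<in> nsets M 2. e \<inter> B = {}} = nsets (M - B) 2"
    "{B \<in> nsets M (N - 2). e \<inter> B = {}} = nsets (M - e) (N - 2)" for e B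
    by (auto simp: nsets_def)
  have "(\<Sum>A\<in>nsets M N. \<Sum>e\<in>nsets A 2. \<phi> e) =
      (\<Sum>B\<in>nsets M (N - 2). \<Sum>e\<in>{e \<in> nsets M 2. e \<inter> B = {}}. \<phi> e)"
    using sum_nsets_edges_complement[OF assms, of "\<lambda>e _. \<phi> e"] by (simp add: sets)
  also have "\<dots> = (\<Sum>e\<in>nsets M 2. \<Sum>B\<in>{B \<in> nsets M (N - 2). e \<inter> B = {}}. \<phi> e)"
    using assms by (intro sum.swap_restrict) (auto simp: finite_imp_finite_nsets)
  also have "\<dots> = (\<Sum>e\<in>nsets M 2. ((card M - 2) choose (N - 2)) * \<phi> e)"
    using assms unfolding sets
  proof (intro sum.cong refl)
    fix e assume "e \<in> nsets M 2"
    then have "card (nsets (M - e) (N - 2)) = (card M - 2) choose (N - 2)"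
      using assms by (subst card_nsets) (auto simp: nsets_def card_Diff_subset)
    then show "(\<Sum>B\<in>nsets (M - e) (N - 2). \<phi> e) = ((card M - 2) choose (N - 2)) * \<phi> e" by simp
  qed
  finally show ?thesis by (simp add: sum_distrib_left)
qed

section \<open>Templates and the monotone extremal density\<close>

lemma finite_templates: "finite (templates k n)"
  unfolding templates_def by (intro finite_PiE) auto

lemma finite_template_entropies:
  "finite {entropy k n t |t. t \<in> templates k n \<and> realisations k n t \<subseteq> P n}"
proof -
  have "{entropy k n t |t. t \<in> templates k n \<and> realisations k n t \<subseteq> P n} \<subseteq> entropy k n ` templates k n"
    by auto
  then show ?thesis using finite_templates finite_subset by blast
qed

lemma realisations_eq_PiE:
  assumes "t \<in> templates k n"
  shows "realisations k n t = (\<Pi>\<^sub>E e\<in>nsets {1..n} 2. t e)"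
  using assms unfolding realisations_def templates_def colourings_def
  by (fastforce simp: PiE_iff)

text \<open>Any colouring in \<open>P n\<close> yields a template with singleton values, so the
  maximum defining \<open>extremal_entropy\<close> is over a nonempty set and is attained.\<close>

lemma extremal_template:
  assumes "order_hereditary k P" "P n \<noteq> {}"
  obtains t where "t \<in> templates k n" "realisations k n t \<subseteq> P n"
    "entropy k n t = extremal_entropy k n P"
proof -
  obtain c where c: "c \<in> P n" using assms by blast
  then have col: "c \<in> colourings k n" using assms by (auto simp: order_hereditary_def)
  define t where "t = (\<lambda>e\<in>nsets {1..n} 2. {c e})"
  have t: "t \<in> templates k n"
    using col by (auto simp: t_def templates_def colourings_def PiE_iff)
  have "realisations k n t \<subseteq> {c}"
    unfolding realisations_eq_PiE[OF t] using col
    by (auto simp: t_def colourings_def PiE_iff intro!: extensionalityI[of _ "nsets {1..n} 2" c])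
  then have "{entropy k n t |t. t \<in> templates k n \<and> realisations k n t \<subseteq> P n} \<noteq> {}"
    using t c by blast
  from Max_in[OF finite_template_entropies[where P = P] this] that show thesis
    unfolding extremal_entropy_def by force
qed

text \<open>The local template is carried to \<open>{1..card A}\<close> along the increasing
  enumeration of \<open>A\<close>, and heredity makes the result admissible. Only the pattern on
  \<open>A\<close> has to extend to a member of \<open>P n\<close>, so edges outside
  \<open>A\<close> may be coloured arbitrarily.\<close>

lemma sum_log_le_extremal_entropy:
  assumes P: "order_hereditary k P" and A: "A \<subseteq> {1..n}"
    and t: "\<And>e. e \<in> nsets A 2 \<Longrightarrow> t e \<subseteq> {1..k} \<and> t e \<noteq> {}"
    and real: "\<And>x. x \<in> (\<Pi>\<^sub>E e\<in>nsets A 2. t e) \<Longrightarrow> \<exists>c\<in>P n. \<forall>e\<in>nsets A 2. c e = x e"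
  shows "(\<Sum>e\<in>nsets A 2. log k (card (t e))) \<le> extremal_entropy k (card A) P"
proof -
  let ?m = "card A"
  define \<phi> where "\<phi> = (\<lambda>i. sorted_list_of_set A ! (i - 1))"
  have fin: "finite A" using A finite_subset by blast
  have "bij_betw (\<lambda>i. sorted_list_of_set A ! i) {..<?m} A"
    using fin by (intro bij_betw_nth) auto
  moreover have "bij_betw (\<lambda>i::nat. i - 1) {1..?m} {..<?m}"
    by (rule bij_betw_byWitness[where f' = Suc]) auto
  ultimately have \<phi>: "bij_betw \<phi> {1..?m} A"
    unfolding \<phi>_def using bij_betw_trans by (fastforce simp: o_def)
  then have \<phi>E: "bij_betw ((`) \<phi>) (nsets {1..?m} 2) (nsets A 2)"
    by (rule bij_betw_nsets)
  define t' where "t' = (\<lambda>e\<in>nsets {1..?m} 2. t (\<phi> ` e))"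
  have t': "t' \<in> templates k ?m"
    using t bij_betw_apply[OF \<phi>E] by (auto simp: t'_def templates_def PiE_iff)
  have "realisations k ?m t' \<subseteq> P ?m"
  proof
    fix c' assume "c' \<in> realisations k ?m t'"
    then have c': "c' \<in> (\<Pi>\<^sub>E e\<in>nsets {1..?m} 2. t' e)" using realisations_eq_PiE[OF t'] by simp
    \<comment> \<open>\<open>\<psi>\<close> inverts the relabelling of edges; \<open>x\<close> is
      \<open>c'\<close> moved onto \<open>A\<close>, so that a colouring extending \<open>x\<close>
      restricts back to \<open>c'\<close>.\<close>
    define \<psi> where "\<psi> = inv_into (nsets {1..?m} 2) ((`) \<phi>)"
    define x where "x = (\<lambda>e\<in>nsets A 2. c' (\<psi> e))"
    have \<psi>: "\<psi> e \<in> nsets {1..?m} 2" "\<phi> ` (\<psi> e) = e" if "e \<in> nsets A 2" for e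
      using that \<phi>E unfolding \<psi>_def bij_betw_def
      by (metis inv_into_into, metis f_inv_into_f)
    have \<psi>': "\<psi> (\<phi> ` e) = e" if "e \<in> nsets {1..?m} 2" for e
      using that \<phi>E unfolding \<psi>_def bij_betw_def by (metis inv_into_f_f)
    have "x \<in> (\<Pi>\<^sub>E e\<in>nsets A 2. t e)"
    proof (rule PiE_I)
      fix e assume e: "e \<in> nsets A 2"
      have "c' (\<psi> e) \<in> t' (\<psi> e)" using c' \<psi>(1)[OF e] by (auto simp: PiE_iff)
      then show "x e \<in> t e" using \<psi>[OF e] e by (simp add: x_def t'_def)
    qed (simp add: x_def)
    then obtain c where c: "c \<in> P n" "\<forall>e\<in>nsets A 2. c e = x e" using real by blast
    have "restriction c A = c'"
    proof
      fix e
      show "restriction c A e = c' e"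
      proof (cases "e \<in> nsets {1..?m} 2")
        case True
        then show ?thesis
          using c(2) bij_betw_apply[OF \<phi>E True] \<psi>' unfolding restriction_def \<phi>_def[symmetric]
          by (simp add: x_def)
      next
        case False
        then show ?thesis using c' by (auto simp: restriction_def PiE_iff extensional_def)
      qed
    qed
    then show "c' \<in> P ?m" using P A c(1) by (auto simp: order_hereditary_def)
  qed
  then have "entropy k ?m t' \<le> extremal_entropy k ?m P"
    unfolding extremal_entropy_def using t' by (intro Max_ge finite_template_entropies) blast
  also have "entropy k ?m t' = (\<Sum>e\<in>nsets {1..?m} 2. log k (card (t (\<phi> ` e))))"
    by (simp add: entropy_def t'_def)
  also have "\<dots> = (\<Sum>e\<in>nsets A 2. log k (card (t e)))"
    using sum.reindex_bij_betw[OF \<phi>E, of "\<lambda>e. log k (card (t e))"] by simp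
  finally show ?thesis .
qed

text \<open>An optimal template on \<open>n\<close> vertices restricts to an admissible one on every
  \<open>N\<close>-set. Averaging over all \<open>N\<close>-sets, each edge being counted equally
  often, gives the inequality.\<close>

lemma extremal_density_antimono:
  assumes P: "order_hereditary k P" "\<And>n. P n \<noteq> {}" and N: "2 \<le> N" "N \<le> n"
  shows "extremal_entropy k n P / (n choose 2) \<le> extremal_entropy k N P / (N choose 2)"
proof -
  obtain t where t: "t \<in> templates k n" "realisations k n t \<subseteq> P n"
    "entropy k n t = extremal_entropy k n P"
    using extremal_template[OF P(1), of n] P(2) by blast
  let ?V = "{1..n}" and ?\<phi> = "\<lambda>e. log k (card (t e))"
  have te: "t e \<subseteq> {1..k} \<and> t e \<noteq> {}" if "e \<in> nsets ?V 2" for e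
    using t(1) that by (auto simp: templates_def PiE_iff)
  have "(\<Sum>e\<in>nsets A 2. ?\<phi> e) \<le> extremal_entropy k N P" if A: "A \<in> nsets ?V N" for A
  proof -
    have A': "A \<subseteq> ?V" "card A = N" using A by (auto simp: nsets_def)
    then have sub: "nsets A 2 \<subseteq> nsets ?V 2" by (simp add: nsets_mono)
    have "(\<Sum>e\<in>nsets A 2. ?\<phi> e) \<le> extremal_entropy k (card A) P"
    proof (rule sum_log_le_extremal_entropy[OF P(1) A'(1)])
      fix x assume x: "x \<in> (\<Pi>\<^sub>E e\<in>nsets A 2. t e)"
      \<comment> \<open>Outside \<open>A\<close> any allowed colour will do, since only an extension
        of \<open>x\<close> is wanted.\<close>
      define c where
        "c = (\<lambda>e\<in>nsets ?V 2. if e \<in> nsets A 2 then x e else (SOME a. a \<in> t e))"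
      have "c \<in> realisations k n t"
        unfolding realisations_eq_PiE[OF t(1)]
        using x te by (auto simp: c_def PiE_iff some_in_eq)
      then show "\<exists>c\<in>P n. \<forall>e\<in>nsets A 2. c e = x e"
        using t(2) sub by (intro bexI[of _ c]) (auto simp: c_def)
    qed (use te sub in blast)
    then show ?thesis using A' by simp
  qed
  then have "(\<Sum>A\<in>nsets ?V N. \<Sum>e\<in>nsets A 2. ?\<phi> e) \<le> card (nsets ?V N) * extremal_entropy k N P"
    by (rule sum_bounded_above)
  then have "((n - 2) choose (N - 2)) * extremal_entropy k n P \<le> (n choose N) * extremal_entropy k N P"
    using N t(3) by (simp add: sum_nsets_edges card_nsets entropy_def)
  then have "((n - 2) choose (N - 2)) * extremal_entropy k n P * ((n choose 2) * (N choose 2)) \<le>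
      (n choose N) * extremal_entropy k N P * ((n choose 2) * (N choose 2))"
    by (rule mult_right_mono) simp
  also have "\<dots> = ((n choose N) * (N choose 2)) * (n choose 2) * extremal_entropy k N P"
    by (simp add: mult_ac)
  also have "(n choose N) * (N choose 2) = (n choose 2) * ((n - 2) choose (N - 2))"
    using N by (intro choose_mult) auto
  finally have "(real ((n - 2) choose (N - 2)) * (n choose 2)) * (extremal_entropy k n P * (N choose 2)) \<le>
      (real ((n - 2) choose (N - 2)) * (n choose 2)) * (extremal_entropy k N P * (n choose 2))"
    by (simp add: mult_ac)
  then have "extremal_entropy k n P * (N choose 2) \<le> extremal_entropy k N P * (n choose 2)"
    using N by (subst (asm) mult_le_cancel_left_pos) auto
  then show ?thesis using N by (simp add: field_simps)
qed

lemma extremal_entropy_nonneg: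
  assumes "2 \<le> k" "order_hereditary k P" "P n \<noteq> {}"
  shows "0 \<le> extremal_entropy k n P"
proof -
  obtain t where t: "t \<in> templates k n" "entropy k n t = extremal_entropy k n P"
    using extremal_template[OF assms(2,3)] by blast
  have "1 \<le> real (card (t e))" if "e \<in> nsets {1..n} 2" for e
  proof -
    have "t e \<subseteq> {1..k}" "t e \<noteq> {}" using t(1) that by (auto simp: templates_def PiE_iff)
    then have "card (t e) \<noteq> 0" using finite_subset by fastforce
    then show ?thesis by linarith
  qed
  then have "0 \<le> entropy k n t"
    unfolding entropy_def using assms(1) by (intro sum_nonneg zero_le_log_cancel_iff[THEN iffD2]) force+
  then show ?thesis using t by simp
qed

lemma extremal_density_tendsto:
  assumes "2 \<le> k" "order_hereditary k P" "\<And>n. P n \<noteq> {}"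
  shows "(\<lambda>n. extremal_entropy k n P / real (n choose 2)) \<longlonglongrightarrow> entropy_density k P"
    and "2 \<le> n \<Longrightarrow> entropy_density k P \<le> extremal_entropy k n P / real (n choose 2)"
proof -
  let ?X = "\<lambda>n. extremal_entropy k n P / real (n choose 2)"
  \<comment> \<open>The shift by 2 skips the terms with \<open>n choose 2 = 0\<close>, whose
    quotient is 0 by convention and would break monotonicity.\<close>
  have dec: "decseq (\<lambda>n. ?X (n + 2))"
    unfolding decseq_def using extremal_density_antimono[OF assms(2,3)] by simp
  have "0 \<le> ?X n" for n
    using extremal_entropy_nonneg[OF assms(1,2,3)] by simp
  then obtain L where L: "(\<lambda>n. ?X (n + 2)) \<longlonglongrightarrow> L"
    using decseq_convergent[OF dec] by blast
  then have lim: "?X \<longlonglongrightarrow> L" by (rule LIMSEQ_offset)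
  then have eq: "entropy_density k P = L" unfolding entropy_density_def by (rule limI)
  show "?X \<longlonglongrightarrow> entropy_density k P" using lim eq by simp
  show "entropy_density k P \<le> ?X n" if "2 \<le> n"
    using decseq_ge[OF dec L, of "n - 2"] that eq by (metis le_add_diff_inverse2)
qed

text \<open>For a template \<open>t\<close>, \<open>k\<close> to the power of its entropy is exactly
  the number of its realisations.\<close>

lemma powr_extremal_entropy_le_card:
  assumes "2 \<le> k" "order_hereditary k P" "P n \<noteq> {}"
  shows "real k powr extremal_entropy k n P \<le> card (P n)"
proof -
  obtain t where t: "t \<in> templates k n" "realisations k n t \<subseteq> P n"
    "entropy k n t = extremal_entropy k n P"
    using extremal_template[OF assms(2,3)] by blast
  have pos: "0 < card (t e)" if "e \<in> nsets {1..n} 2" for e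
  proof -
    have "t e \<subseteq> {1..k}" "t e \<noteq> {}" using t(1) that by (auto simp: templates_def PiE_iff)
    then show ?thesis using finite_subset by (fastforce simp: card_gt_0_iff)
  qed
  have "real k powr entropy k n t = (\<Prod>e\<in>nsets {1..n} 2. real k powr log k (card (t e)))"
    using assms(1) by (simp add: entropy_def powr_sum)
  also have "\<dots> = (\<Prod>e\<in>nsets {1..n} 2. real (card (t e)))"
    using assms(1) pos by (intro prod.cong) auto
  also have "\<dots> = card (realisations k n t)"
    by (subst realisations_eq_PiE[OF t(1)], subst card_PiE) auto
  also have "\<dots> \<le> card (P n)"
  proof -
    have "P n \<subseteq> colourings k n" using assms by (auto simp: order_hereditary_def)
    moreover have "finite (colourings k n)" unfolding colourings_def by (intro finite_PiE) auto
    ultimately show ?thesis using t(2) by (auto intro!: card_mono intro: finite_subset)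
  qed
  finally show ?thesis using t(3) by simp
qed

section \<open>Conditional entropy of edges\<close>

definition joint_ent :: "('e \<Rightarrow> 'v) set \<Rightarrow> 'e set \<Rightarrow> real" where
  "joint_ent \<Omega> D = ent \<Omega> (\<lambda>c. restrict c D)"

lemma restrict_eq_restrict_iff: "restrict c D = restrict c' D \<longleftrightarrow> (\<forall>x\<in>D. c x = c' x)"
  by (auto simp: restrict_def fun_eq_iff)

lemma ent_eq_joint_ent:
  assumes "\<And>c c'. c \<in> \<Omega> \<Longrightarrow> c' \<in> \<Omega> \<Longrightarrow> f c = f c' \<longleftrightarrow> (\<forall>x\<in>D. c x = c' x)"
  shows "ent \<Omega> f = joint_ent \<Omega> D"
  unfolding joint_ent_def using assms by (intro ent_cong) (auto simp: restrict_eq_restrict_iff)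

text \<open>Conditional entropy of the colour of \<open>e\<close> given the colours on
  \<open>D\<close>. It vanishes for \<open>e \<in> D\<close>, so sums over all edges ignore those
  already revealed.\<close>

definition edge_ent :: "('e \<Rightarrow> 'v) set \<Rightarrow> 'e set \<Rightarrow> 'e \<Rightarrow> real" where
  "edge_ent \<Omega> D e = joint_ent \<Omega> (insert e D) - joint_ent \<Omega> D"

context
  fixes \<Omega> :: "('e \<Rightarrow> 'v) set"
  assumes fin: "finite \<Omega>" "\<Omega> \<noteq> {}"
begin

lemma joint_ent_empty: "joint_ent \<Omega> {} = 0"
  using fin by (simp add: joint_ent_def ent_def freq_def restrict_def)

lemma edge_ent_nonneg: "0 \<le> edge_ent \<Omega> D e"
proof -
  have "ent \<Omega> (\<lambda>c. (c e, restrict c D)) = joint_ent \<Omega> (insert e D)"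
    by (rule ent_eq_joint_ent) (auto simp: restrict_eq_restrict_iff)
  then show ?thesis
    using ent_mono[OF fin, of "\<lambda>c. restrict c D" "\<lambda>c. c e"] by (simp add: edge_ent_def joint_ent_def)
qed

text \<open>Submodularity: as \<open>D \<subseteq> D'\<close>, the restrictions to \<open>D'\<close>
  and \<open>D\<close> together carry the same information as that to \<open>D'\<close>.\<close>

lemma edge_ent_antimono:
  assumes "D \<subseteq> D'"
  shows "edge_ent \<Omega> D' e \<le> edge_ent \<Omega> D e"
proof -
  have "ent \<Omega> (\<lambda>c. (restrict c {e}, restrict c D', restrict c D)) = joint_ent \<Omega> (insert e D')"
    "ent \<Omega> (\<lambda>c. (restrict c {e}, restrict c D)) = joint_ent \<Omega> (insert e D)"
    "ent \<Omega> (\<lambda>c. (restrict c D', restrict c D)) = joint_ent \<Omega> D'"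
    using subsetD[OF assms] by (auto intro!: ent_eq_joint_ent simp: restrict_eq_restrict_iff)
  then show ?thesis
    using ent_submodular[OF fin, of "\<lambda>c. restrict c {e}" "\<lambda>c. restrict c D'" "\<lambda>c. restrict c D"]
    by (simp add: edge_ent_def flip: joint_ent_def)
qed

lemma edge_ent_le:
  assumes "finite K" "\<And>c. c \<in> \<Omega> \<Longrightarrow> c e \<in> K"
  shows "edge_ent \<Omega> D e \<le> ln (card K)"
proof -
  have "edge_ent \<Omega> D e \<le> edge_ent \<Omega> {} e" by (rule edge_ent_antimono) simp
  also have "\<dots> = joint_ent \<Omega> {e}"
    by (simp only: edge_ent_def joint_ent_empty diff_zero)
  also have "\<dots> = ent \<Omega> (\<lambda>c. c e)"
    by (rule ent_eq_joint_ent[symmetric]) auto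
  also have "\<dots> \<le> ln (card K)" using fin assms by (intro ent_le_ln_card) auto
  finally show ?thesis .
qed

lemma joint_ent_union_le:
  assumes "finite F"
  shows "joint_ent \<Omega> (D \<union> F) \<le> joint_ent \<Omega> D + (\<Sum>e\<in>F. edge_ent \<Omega> D e)"
  using assms
proof (induction F)
  case (insert e F)
  have "edge_ent \<Omega> (D \<union> F) e \<le> edge_ent \<Omega> D e" by (rule edge_ent_antimono) simp
  then show ?case using insert by (simp add: edge_ent_def)
qed simp

text \<open>The edges of \<open>F\<close> are added one at a time. Whatever is known before
  \<open>e\<close> lies in \<open>U e\<close>, and conditioning on the larger set can only lower the
  entropy of \<open>e\<close>.\<close>

lemma joint_ent_union_ge:
  assumes "finite F" "\<And>e. e \<in> F \<Longrightarrow> D \<union> (F - {e}) \<subseteq> U e"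
  shows "joint_ent \<Omega> D + (\<Sum>e\<in>F. edge_ent \<Omega> (U e) e) \<le> joint_ent \<Omega> (D \<union> F)"
  using assms
proof (induction F)
  case (insert e F)
  have "edge_ent \<Omega> (U e) e \<le> edge_ent \<Omega> (D \<union> F) e"
    using insert.hyps insert.prems[of e] by (intro edge_ent_antimono) auto
  moreover have "joint_ent \<Omega> D + (\<Sum>e\<in>F. edge_ent \<Omega> (U e) e) \<le>
      joint_ent \<Omega> (D \<union> F)"
    using insert.prems by (intro insert.IH) blast
  ultimately show ?case using insert.hyps by (simp add: edge_ent_def)
qed simp

lemma joint_ent_le:
  assumes "finite F" "finite K" "\<And>c e. c \<in> \<Omega> \<Longrightarrow> e \<in> F \<Longrightarrow> c e \<in> K"
  shows "joint_ent \<Omega> F \<le> card F * ln (card K)"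
proof -
  have "joint_ent \<Omega> ({} \<union> F) \<le> joint_ent \<Omega> {} + (\<Sum>e\<in>F. edge_ent \<Omega> {} e)"
    using assms(1) by (rule joint_ent_union_le)
  also have "(\<Sum>e\<in>F. edge_ent \<Omega> {} e) \<le> card F * ln (card K)"
    using assms by (intro sum_bounded_above edge_ent_le) auto
  finally show ?thesis unfolding joint_ent_empty by simp
qed

end

section \<open>Choosing the revealed vertices, a typical vertex set and a good cell\<close>

definition touching :: "'a set \<Rightarrow> 'a set \<Rightarrow> 'a set set" where
  "touching V S = {e \<in> nsets V 2. e \<inter> S \<noteq> {}}"

lemma card_touching_le:
  assumes "finite V" "S \<subseteq> V"
  shows "card (touching V S) \<le> card S * card V"
proof -
  have "touching V S \<subseteq> (\<lambda>(x, y). {x, y}) ` (S \<times> V)"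
  proof
    fix e assume "e \<in> touching V S"
    then obtain x where e: "e \<in> nsets V 2" "x \<in> e" "x \<in> S" by (auto simp: touching_def)
    then obtain y where "e = {x, y}" "y \<in> V" by (auto elim!: nsets2_E)
    then show "e \<in> (\<lambda>(x, y). {x, y}) ` (S \<times> V)" using e by auto
  qed
  then have "card (touching V S) \<le> card (S \<times> V)"
    using assms by (meson card_image_le card_mono finite_SigmaI finite_imageI finite_subset le_trans)
  then show ?thesis by (simp add: card_cartesian_product)
qed

text \<open>\<open>S\<close> minimises \<open>\<Phi> S + \<eta> * card S\<close>. Comparison with
  the empty set bounds its size, and comparison with \<open>S \<union> B\<close> gives stability, so
  no iterated refinement is required.\<close>

lemma penalised_minimiser:
  fixes \<Phi> :: "'a set \<Rightarrow> real" and \<eta> :: real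
  assumes "finite V" "0 < \<eta>" "\<And>S. 0 \<le> \<Phi> S"
  obtains S where "S \<subseteq> V" "\<eta> * card S \<le> \<Phi> {}"
    "\<And>B. B \<subseteq> V \<Longrightarrow> \<Phi> S - \<Phi> (S \<union> B) \<le> \<eta> * card B"
proof -
  let ?f = "\<lambda>S. \<Phi> S + \<eta> * card S"
  have "Min (?f ` Pow V) \<in> ?f ` Pow V" using assms by (intro Min_in) auto
  then obtain S where S: "S \<subseteq> V" "?f S = Min (?f ` Pow V)" by auto
  then have min: "?f S \<le> ?f T" if "T \<subseteq> V" for T using assms(1) that by auto
  show thesis
  proof
    show "S \<subseteq> V" by fact
    show "\<eta> * card S \<le> \<Phi> {}" using min[of "{}"] assms(3)[of S] by simp
    fix B assume "B \<subseteq> V"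
    then have "?f S \<le> ?f (S \<union> B)" using S by (intro min) auto
    also have "real (card (S \<union> B)) \<le> card S + card B" using card_Un_le[of S B] by linarith
    then have "?f (S \<union> B) \<le> \<Phi> (S \<union> B) + \<eta> * (card S + card B)"
      using assms(2) by simp
    finally show "\<Phi> S - \<Phi> (S \<union> B) \<le> \<eta> * card B" by (simp add: algebra_simps)
  qed
qed

text \<open>First moment over the \<open>N\<close>-subsets of \<open>V - S\<close>. The entropies
  average to their edge density; the losses become, by \<open>sum_nsets_edges_complement\<close>,
  drops caused by revealing a single \<open>(N - 2)\<close>-set, which \<open>stable\<close> bounds.
  Combining both into one score with weight \<open>K\<close> lets one \<open>A\<close> control
  both.\<close>

lemma exists_good_vertex_subset:
  fixes h :: "'a set \<Rightarrow> 'a set \<Rightarrow> real" and K \<eta> :: real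
  assumes V: "finite V" "S \<subseteq> V" and N: "2 \<le> N" "N \<le> card (V - S)" and K: "0 \<le> K"
    and anti: "\<And>e S T. S \<subseteq> T \<Longrightarrow> h e T \<le> h e S"
    and stable: "\<And>B. B \<subseteq> V \<Longrightarrow>
      (\<Sum>e\<in>nsets V 2. h e S) - (\<Sum>e\<in>nsets V 2. h e (S \<union> B)) \<le> \<eta> * card B"
  obtains A where "A \<in> nsets (V - S) N"
    "(N choose 2) * ((\<Sum>e\<in>nsets (V - S) 2. h e S) / (card (V - S) choose 2)
        - K * \<eta> * N / ((card (V - S) - (N - 2)) choose 2))
      \<le> (\<Sum>e\<in>nsets A 2. h e S) - K * (\<Sum>e\<in>nsets A 2. h e S - h e (S \<union> (A - e)))"
proof -
  let ?M = "V - S"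
  let ?m = "card ?M" and ?s = "\<Sum>e\<in>nsets ?M 2. h e S"
  let ?w = "\<lambda>A. (\<Sum>e\<in>nsets A 2. h e S) - K * (\<Sum>e\<in>nsets A 2. h e S - h e (S \<union> (A - e)))"
  let ?\<theta> = "(N choose 2) * (?s / (?m choose 2) - K * \<eta> * N / ((?m - (N - 2)) choose 2))"
  have finM: "finite ?M" using V by simp
  \<comment> \<open>The sign of \<open>\<eta>\<close> follows from stability against a single
    vertex.\<close>
  have \<eta>: "0 \<le> \<eta>"
  proof -
    obtain v where "v \<in> V - S" using N V by (metis card.empty equals0I not_numeral_le_zero le_trans)
    then have v: "v \<in> V" by simp
    have "(\<Sum>e\<in>nsets V 2. h e (S \<union> {v})) \<le> (\<Sum>e\<in>nsets V 2. h e S)"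
      by (intro sum_mono anti) auto
    then show ?thesis using stable[of "{v}"] v by simp
  qed
  have loss: "(\<Sum>e\<in>nsets (?M - B) 2. h e S - h e (S \<union> B)) \<le> \<eta> * N" if B: "B \<in> nsets ?M (N - 2)" for B
  proof -
    have B': "B \<subseteq> V" "card B = N - 2" using B by (auto simp: nsets_def)
    have "(\<Sum>e\<in>nsets (?M - B) 2. h e S - h e (S \<union> B)) \<le> (\<Sum>e\<in>nsets V 2. h e S - h e (S \<union> B))"
      using V anti[of S "S \<union> B"] by (intro sum_mono2 nsets_mono) auto
    also have "\<dots> \<le> \<eta> * card B" using stable[OF B'(1)] by (simp add: sum_subtractf)
    also have "\<dots> \<le> \<eta> * N" using \<eta> B' by (intro mult_left_mono) auto
    finally show ?thesis .
  qed
  have pos: "0 < real (?m choose 2)" "0 < real ((?m - (N - 2)) choose 2)" using N by auto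
  have "(\<Sum>A\<in>nsets ?M N. \<Sum>e\<in>nsets A 2. h e S - h e (S \<union> (A - e))) =
      (\<Sum>B\<in>nsets ?M (N - 2). \<Sum>e\<in>nsets (?M - B) 2. h e S - h e (S \<union> B))"
    by (rule sum_nsets_edges_complement[OF finM N(1), of "\<lambda>e B. h e S - h e (S \<union> B)"])
  also have "\<dots> \<le> real (card (nsets ?M (N - 2))) * (\<eta> * N)"
    using loss by (rule sum_bounded_above)
  also have "real (card (nsets ?M (N - 2))) = (?m choose N) * (N choose 2) / ((?m - (N - 2)) choose 2)"
  proof -
    have "(?m choose N) * (N choose (N - 2)) = (?m choose (N - 2)) * ((?m - (N - 2)) choose (N - (N - 2)))"
      using N by (intro choose_mult) auto
    moreover have "N choose (N - 2) = N choose 2" "N - (N - 2) = 2"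
      using N by (auto simp: binomial_symmetric[of 2 N])
    ultimately have "(?m choose N) * (N choose 2) = (?m choose (N - 2)) * ((?m - (N - 2)) choose 2)"
      by simp
    then show ?thesis
      using pos finM by (simp add: card_nsets field_simps flip: of_nat_mult)
  qed
  finally have loss_le: "K * (\<Sum>A\<in>nsets ?M N. \<Sum>e\<in>nsets A 2. h e S - h e (S \<union> (A - e))) \<le>
      K * ((?m choose N) * (N choose 2) / ((?m - (N - 2)) choose 2) * (\<eta> * N))"
    using K by (rule mult_left_mono)
  have gain: "(\<Sum>A\<in>nsets ?M N. \<Sum>e\<in>nsets A 2. h e S) = (?m choose N) * (N choose 2) / (?m choose 2) * ?s"
  proof -
    have "(?m choose N) * (N choose 2) = (?m choose 2) * ((?m - 2) choose (N - 2))"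
      using N by (intro choose_mult) auto
    then have "real ((?m - 2) choose (N - 2)) = (?m choose N) * (N choose 2) / (?m choose 2)"
      using pos by (simp add: field_simps flip: of_nat_mult)
    then show ?thesis using sum_nsets_edges[OF finM N(1), of "\<lambda>e. h e S"] by simp
  qed
  have total: "(\<Sum>A\<in>nsets ?M N. ?w A) = (\<Sum>A\<in>nsets ?M N. \<Sum>e\<in>nsets A 2. h e S) -
      K * (\<Sum>A\<in>nsets ?M N. \<Sum>e\<in>nsets A 2. h e S - h e (S \<union> (A - e)))"
    by (simp add: sum_subtractf flip: sum_distrib_left)
  have threshold: "(?m choose N) * ?\<theta> = (?m choose N) * (N choose 2) / (?m choose 2) * ?s -
      K * ((?m choose N) * (N choose 2) / ((?m - (N - 2)) choose 2) * (\<eta> * N))"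
    by (simp add: algebra_simps)
  have "(?m choose N) * ?\<theta> \<le> (\<Sum>A\<in>nsets ?M N. ?w A)"
    unfolding total threshold gain by (rule diff_left_mono[OF loss_le])
  moreover have "nsets ?M N \<noteq> {}" using N finM by (simp add: nsets_eq_empty_iff)
  ultimately have "\<not> (\<forall>A\<in>nsets ?M N. ?w A < ?\<theta>)"
    using sum_strict_mono[of "nsets ?M N" ?w "\<lambda>_. ?\<theta>"] finM by (auto simp: card_nsets)
  then show thesis using that by (meson not_le)
qed

text \<open>A cell collects the colourings agreeing on all edges that touch \<open>S\<close>. By the
  chain rule, conditional entropies are averages over cells, while \<open>joint_ent_union_ge\<close>
  bounds the average joint entropy on \<open>A\<close> from below. Some cell scores at least the
  average.\<close>

lemma exists_good_cell:
  fixes \<Omega> :: "('a set \<Rightarrow> 'v) set"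
  assumes fin: "finite \<Omega>" "\<Omega> \<noteq> {}" and V: "finite V" "A \<subseteq> V" and K: "0 \<le> K"
  obtains C where "C \<subseteq> \<Omega>" "C \<noteq> {}"
    "(\<Sum>e\<in>nsets A 2. edge_ent \<Omega> (touching V S) e) - K * (\<Sum>e\<in>nsets A 2.
        edge_ent \<Omega> (touching V S) e - edge_ent \<Omega> (touching V (S \<union> (A - e))) e) \<le>
     (\<Sum>e\<in>nsets A 2. ent C (\<lambda>c. c e)) -
       K * ((\<Sum>e\<in>nsets A 2. ent C (\<lambda>c. c e)) - joint_ent C (nsets A 2))"
proof -
  let ?D = "touching V S" and ?E = "nsets A 2" and ?n = "real (card \<Omega>)"
  define C where "C c = {c' \<in> \<Omega>. restrict c' ?D = restrict c ?D}" for c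
  have n: "0 < ?n" using fin by (simp add: card_gt_0_iff)
  have finA: "finite A" using V finite_subset by blast
  let ?w = "\<lambda>C. (\<Sum>e\<in>?E. ent C (\<lambda>c. c e)) - K * ((\<Sum>e\<in>?E. ent C (\<lambda>c. c e)) - joint_ent C ?E)"
  let ?\<theta> = "(\<Sum>e\<in>?E. edge_ent \<Omega> ?D e) - K * (\<Sum>e\<in>?E.
        edge_ent \<Omega> ?D e - edge_ent \<Omega> (touching V (S \<union> (A - e))) e)"
  have single: "(\<Sum>c\<in>\<Omega>. ent (C c) (\<lambda>c. c e)) / ?n = edge_ent \<Omega> ?D e" for e
  proof -
    have "ent \<Omega> (\<lambda>c. (c e, restrict c ?D)) = joint_ent \<Omega> (insert e ?D)"
      by (rule ent_eq_joint_ent) (auto simp: restrict_eq_restrict_iff)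
    then show ?thesis
      using ent_chain[OF fin, of "\<lambda>c. c e" "\<lambda>c. restrict c ?D"] by (simp add: C_def edge_ent_def flip: joint_ent_def)
  qed
  have joint: "(\<Sum>e\<in>?E. edge_ent \<Omega> (touching V (S \<union> (A - e))) e) \<le>
      (\<Sum>c\<in>\<Omega>. joint_ent (C c) ?E) / ?n"
  proof -
    \<comment> \<open>Two distinct edges cannot contain each other, so every edge of
      \<open>A\<close> other than \<open>e\<close> has a vertex in \<open>A - e\<close>.\<close>
    have "?D \<union> (?E - {e}) \<subseteq> touching V (S \<union> (A - e))" if "e \<in> ?E" for e
    proof
      fix f assume f: "f \<in> ?D \<union> (?E - {e})"
      show "f \<in> touching V (S \<union> (A - e))"
      proof (cases "f \<in> ?D")
        case False
        then have "f \<subseteq> A" "card f = 2" "card e = 2" "finite e" "f \<noteq> e"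
          using f that by (auto simp: nsets_def)
        then have "f \<inter> (A - e) \<noteq> {}" using card_subset_eq[of e f] by auto
        moreover have "f \<in> nsets V 2" using False f nsets_mono[OF V(2)] by blast
        ultimately show ?thesis by (auto simp: touching_def)
      qed (auto simp: touching_def)
    qed
    then have "joint_ent \<Omega> ?D + (\<Sum>e\<in>?E. edge_ent \<Omega> (touching V (S \<union> (A - e))) e)
        \<le> joint_ent \<Omega> (?D \<union> ?E)"
      using finA by (intro joint_ent_union_ge[OF fin]) auto
    moreover have "ent \<Omega> (\<lambda>c. (restrict c ?E, restrict c ?D)) = joint_ent \<Omega> (?D \<union> ?E)"
      by (rule ent_eq_joint_ent) (auto simp: restrict_eq_restrict_iff)
    ultimately show ?thesis
      using ent_chain[OF fin, of "\<lambda>c. restrict c ?E" "\<lambda>c. restrict c ?D"]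
      by (simp add: C_def flip: joint_ent_def)
  qed
  have singles: "(\<Sum>e\<in>?E. edge_ent \<Omega> ?D e) = (\<Sum>c\<in>\<Omega>. \<Sum>e\<in>?E. ent (C c) (\<lambda>c. c e)) / ?n"
    by (subst sum.swap) (simp add: sum_divide_distrib flip: single)
  have "?\<theta> \<le> (\<Sum>e\<in>?E. edge_ent \<Omega> ?D e) -
      K * ((\<Sum>e\<in>?E. edge_ent \<Omega> ?D e) - (\<Sum>c\<in>\<Omega>. joint_ent (C c) ?E) / ?n)"
    using joint K by (simp add: sum_subtractf mult_left_mono)
  moreover have "\<dots> = (\<Sum>c\<in>\<Omega>. ?w (C c)) / ?n"
    unfolding singles
    by (simp add: sum_subtractf diff_divide_distrib right_diff_distrib flip: sum_distrib_left)
  ultimately have "?\<theta> \<le> (\<Sum>c\<in>\<Omega>. ?w (C c)) / ?n" by linarith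
  then have "?n * ?\<theta> \<le> (\<Sum>c\<in>\<Omega>. ?w (C c))"
    using n by (simp add: pos_le_divide_eq mult.commute)
  then have "\<not> (\<forall>c\<in>\<Omega>. ?w (C c) < ?\<theta>)"
    using sum_strict_mono[of \<Omega> "\<lambda>c. ?w (C c)" "\<lambda>_. ?\<theta>"] fin by auto
  then obtain c where "c \<in> \<Omega>" "?\<theta> \<le> ?w (C c)" by (meson not_le)
  then show thesis using that[of "C c"] by (auto simp: C_def)
qed

text \<open>The template keeps the colours of frequency at least \<open>\<delta>\<close>;
  \<open>\<delta> * k < 1\<close> ensures that each edge has one. A missing combination of kept
  colours would have product mass at least \<open>\<delta> ^ card E\<close>, and
  \<open>ent_tuple_le\<close> would contradict \<open>indep\<close>. Discarding rare colours costs
  \<open>3 * k * sqrt \<delta>\<close> per edge.\<close>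

lemma template_of_nearly_independent:
  fixes C :: "('e \<Rightarrow> nat) set" and k :: nat and \<delta> :: real
  assumes C: "finite C" "C \<noteq> {}" and E: "finite E" and vals: "\<forall>c\<in>C. \<forall>e\<in>E. c e \<in> {1..k}"
    and \<delta>: "0 < \<delta>" "\<delta> * k < 1"
    and indep: "(\<Sum>e\<in>E. ent C (\<lambda>c. c e)) - joint_ent C E < \<delta> ^ card E"
  obtains t where "\<And>e. e \<in> E \<Longrightarrow> t e \<subseteq> {1..k} \<and> t e \<noteq> {}"
    "\<And>x. x \<in> (\<Pi>\<^sub>E e\<in>E. t e) \<Longrightarrow> \<exists>c\<in>C. \<forall>e\<in>E. c e = x e"
    "(\<Sum>e\<in>E. ent C (\<lambda>c. c e)) \<le> (\<Sum>e\<in>E. ln (card (t e))) + card E * (3 * k * sqrt \<delta>)"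
proof
  define t where "t = (\<lambda>e. {a \<in> {1..k}. \<delta> \<le> freq C (\<lambda>c. c e) a})"
  show te: "t e \<subseteq> {1..k} \<and> t e \<noteq> {}" if e: "e \<in> E" for e
  proof -
    have False if "t e = {}"
    proof -
      have "1 = (\<Sum>a\<in>{1..k}. freq C (\<lambda>c. c e) a)"
        using C vals e by (intro sum_freq[symmetric]) auto
      also have "\<dots> \<le> (\<Sum>a\<in>{1..k}. \<delta>)" using that by (intro sum_mono) (force simp: t_def)
      finally show False using \<delta> by (simp add: mult.commute)
    qed
    then show ?thesis by (auto simp: t_def)
  qed
  show "\<exists>c\<in>C. \<forall>e\<in>E. c e = x e" if x: "x \<in> (\<Pi>\<^sub>E e\<in>E. t e)" for x
  proof (rule ccontr)
    assume miss: "\<not> (\<exists>c\<in>C. \<forall>e\<in>E. c e = x e)"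
    have fx: "\<delta> \<le> freq C (\<lambda>c. c e) (x e)" if "e \<in> E" for e
      using x that by (auto simp: t_def)
    have "x e \<in> (\<lambda>c. c e) ` C" if "e \<in> E" for e
      using fx[OF that] \<delta> freq_eq_0[of "x e" "\<lambda>c. c e" C] by fastforce
    then have "{x} \<subseteq> (\<Pi>\<^sub>E e\<in>E. (\<lambda>c. c e) ` C)" using x by (auto simp: PiE_iff)
    moreover have "{x} \<inter> (\<lambda>c. \<lambda>e\<in>E. c e) ` C = {}" using miss by (auto simp: restrict_def)
    ultimately have "joint_ent C E + (\<Prod>e\<in>E. freq C (\<lambda>c. c e) (x e)) \<le>
        (\<Sum>e\<in>E. ent C (\<lambda>c. c e))"
      using ent_tuple_le[OF C E, of "{x}" "\<lambda>e c. c e"] by (simp add: joint_ent_def)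
    moreover have "\<delta> ^ card E \<le> (\<Prod>e\<in>E. freq C (\<lambda>c. c e) (x e))"
      using prod_mono[of E "\<lambda>_. \<delta>"] fx \<delta> by simp
    ultimately show False using indep by simp
  qed
  have "(\<Sum>e\<in>E. ent C (\<lambda>c. c e)) \<le> (\<Sum>e\<in>E. ln (card (t e)) + 3 * k * sqrt \<delta>)"
  proof (intro sum_mono)
    fix e assume e: "e \<in> E"
    have "k \<noteq> 0" using te[OF e] by auto
    then have "\<delta> * 1 \<le> \<delta> * k" using \<delta> by (intro mult_left_mono) auto
    then have "\<delta> \<le> 1" using \<delta> by linarith
    then have "ent C (\<lambda>c. c e) \<le> ln (card (t e)) + 3 * card {1..k} * sqrt \<delta>"
      using C te[OF e] vals e \<delta>
      by (intro ent_le_ln_card_frequent) (auto simp: t_def)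
    then show "ent C (\<lambda>c. c e) \<le> ln (card (t e)) + 3 * k * sqrt \<delta>" by simp
  qed
  then show "(\<Sum>e\<in>E. ent C (\<lambda>c. c e)) \<le> (\<Sum>e\<in>E. ln (card (t e))) + card E * (3 * k * sqrt \<delta>)"
    by (simp add: sum.distrib)
qed

section \<open>The counting theorem\<close>

lemma real_choose_two: "real (n choose 2) = real n * (real n - 1) / 2"
  by (induction n) (auto simp: numeral_2_eq_2 field_simps)

text \<open>The entropy of all edges is \<open>ln (card \<Omega>)\<close>. The edges touching
  \<open>S\<close> are bounded trivially, and the others contribute at most their conditional
  entropies.\<close>

lemma ln_card_le_edge_ent:
  assumes fin: "finite \<Omega>" "\<Omega> \<noteq> {}" and V: "finite V" "S \<subseteq> V" and K: "finite K" "K \<noteq> {}"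
    and \<Omega>: "\<Omega> \<subseteq> nsets V 2 \<rightarrow>\<^sub>E K"
  shows "ln (card \<Omega>) \<le> card S * card V * ln (card K) + (\<Sum>e\<in>nsets (V - S) 2. edge_ent \<Omega> (touching V S) e)"
proof -
  have K1: "1 \<le> real (card K)" using K by (simp add: Suc_le_eq card_gt_0_iff)
  have split: "nsets V 2 = touching V S \<union> nsets (V - S) 2" by (auto simp: touching_def nsets_def)
  have "inj_on (\<lambda>c. restrict c (nsets V 2)) \<Omega>"
    using \<Omega> by (intro inj_onI) (metis PiE_restrict subsetD)
  then have "ln (card \<Omega>) = joint_ent \<Omega> (nsets V 2)"
    using fin(1) by (simp add: joint_ent_def ent_inj_on)
  also have "\<dots> \<le> joint_ent \<Omega> (touching V S) + (\<Sum>e\<in>nsets (V - S) 2. edge_ent \<Omega> (touching V S) e)"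
    unfolding split using V by (intro joint_ent_union_le[OF fin]) simp
  also have "joint_ent \<Omega> (touching V S) \<le> card (touching V S) * ln (card K)"
    using V K \<Omega> by (intro joint_ent_le[OF fin]) (auto simp: touching_def PiE_iff)
  also have "\<dots> \<le> real (card S * card V) * ln (card K)"
    using card_touching_le[OF V] K1 by (intro mult_right_mono) (auto simp flip: of_nat_mult)
  finally show ?thesis by simp
qed

text \<open>Of the density \<open>\<theta>\<close>, one \<open>\<beta>\<close> is lost to edges
  touching \<open>S\<close>, one to the weighted dependence loss, and
  \<open>3 * k * sqrt \<delta>\<close> to rare colours.\<close>

lemma template_of_large_entropy:
  fixes k n N :: nat and \<theta> \<beta> \<delta> K :: real
  assumes fin: "finite \<Omega>" "\<Omega> \<noteq> {}" and \<Omega>: "\<Omega> \<subseteq> nsets {1..n} 2 \<rightarrow>\<^sub>E {1..k}" and k: "2 \<le> k"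
    and large: "\<theta> * (n choose 2) \<le> ln (card \<Omega>)"
    and N: "2 \<le> N" and \<beta>: "0 < \<beta>" "2 * \<beta> \<le> \<theta>"
    and \<delta>: "0 < \<delta>" "\<delta> * k < 1" and K: "0 < K" "(N choose 2) * ln k < K * \<delta> ^ (N choose 2)"
    and n: "2 * (8 * K * N * ln k / \<beta> + N + 1) \<le> n" "8 * K * N * (ln k)\<^sup>2 / \<beta>\<^sup>2 \<le> n - 1"
  obtains A t where "A \<in> nsets {1..n} N" "\<And>e. e \<in> nsets A 2 \<Longrightarrow> t e \<subseteq> {1..k} \<and> t e \<noteq> {}"
    "\<And>x. x \<in> (\<Pi>\<^sub>E e\<in>nsets A 2. t e) \<Longrightarrow> \<exists>c\<in>\<Omega>. \<forall>e\<in>nsets A 2. c e = x e"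
    "(N choose 2) * (\<theta> - 2 * \<beta> - 3 * k * sqrt \<delta>) \<le> (\<Sum>e\<in>nsets A 2. ln (card (t e)))"
proof -
  let ?V = "{1..n}" and ?L = "ln (real k)" and ?q = "real (N choose 2)"
  define h where "h e S = edge_ent \<Omega> (touching ?V S) e" for e S
  \<comment> \<open>Quadratic in \<open>n\<close>: large enough that \<open>S\<close> has size
    bounded independently of \<open>n\<close>, small enough that \<open>K * \<eta> * N\<close> is at
    most \<open>\<beta>\<close> times the number of edges left after removing \<open>S\<close> and
    \<open>N - 2\<close> further vertices.\<close>
  define \<eta> where "\<eta> = \<beta> * (real n)\<^sup>2 / (8 * K * N)"
  have L: "0 < ?L" using k by simp
  have vals: "c e \<in> {1..k}" if "c \<in> \<Omega>" "e \<in> nsets ?V 2" for c e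
    using that \<Omega> by (auto simp: PiE_iff)
  have h: "0 \<le> h e S" for e S unfolding h_def by (rule edge_ent_nonneg[OF fin])
  have h_anti: "h e T \<le> h e S" if "S \<subseteq> T" for e S T
    unfolding h_def using that by (intro edge_ent_antimono[OF fin]) (auto simp: touching_def)
  have n2: "2 \<le> n"
  proof -
    have "0 \<le> 8 * K * N * ?L / \<beta>" using K L \<beta> by simp
    then show ?thesis using n(1) N by simp
  qed
  have \<eta>: "0 < \<eta>" using \<beta> K N n2 by (simp add: \<eta>_def)
  obtain S where S: "S \<subseteq> ?V" "\<eta> * card S \<le> (\<Sum>e\<in>nsets ?V 2. h e {})"
    and stable: "\<And>B. B \<subseteq> ?V \<Longrightarrow>
      (\<Sum>e\<in>nsets ?V 2. h e S) - (\<Sum>e\<in>nsets ?V 2. h e (S \<union> B)) \<le> \<eta> * card B"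
    by (rule penalised_minimiser[where V = ?V and \<Phi> = "\<lambda>S. \<Sum>e\<in>nsets ?V 2. h e S",
          OF finite_atLeastAtMost \<eta> sum_nonneg[OF h]]) (rule that)
  have cS: "real (card S) \<le> 4 * K * N * ?L / \<beta>"
  proof -
    have "(\<Sum>e\<in>nsets ?V 2. h e {}) \<le> card (nsets ?V 2) * ?L"
      using edge_ent_le[OF fin, of "{1..k}"] vals by (intro sum_bounded_above) (auto simp: h_def)
    then have "\<eta> * card S \<le> (n choose 2) * ?L"
      using S(2) by (simp add: card_nsets)
    also have "\<dots> \<le> (real n)\<^sup>2 / 2 * ?L"
      using L by (intro mult_right_mono) (auto simp: real_choose_two power2_eq_square algebra_simps)
    finally show ?thesis
      using K \<beta> N n2 by (simp add: \<eta>_def field_simps power2_eq_square)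
  qed
  let ?M = "?V - S"
  let ?m = "card ?M" and ?s = "\<Sum>e\<in>nsets ?M 2. h e S"
  have m: "real ?m = n - card S" "?m \<le> n"
    using S(1) card_mono[of ?V S] by (auto simp: card_Diff_subset finite_subset of_nat_diff)
  \<comment> \<open>The spare \<open>N + 1\<close> keeps more than half of the vertices even after
    \<open>N - 2\<close> more are removed.\<close>
  have half: "n / 2 + N + 1 \<le> ?m"
  proof -
    have "4 * K * N * ?L / \<beta> \<le> 8 * K * N * ?L / \<beta>"
      using K L \<beta> by (simp add: divide_right_mono)
    then show ?thesis using cS m n(1) by simp
  qed
  then have mN: "N \<le> ?m" by linarith
  obtain A where A: "A \<in> nsets ?M N" and good:
    "?q * (?s / (?m choose 2) - K * \<eta> * N / ((?m - (N - 2)) choose 2))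
      \<le> (\<Sum>e\<in>nsets A 2. h e S) - K * (\<Sum>e\<in>nsets A 2. h e S - h e (S \<union> (A - e)))"
    using exists_good_vertex_subset[OF _ S(1) N mN, of K h \<eta>] K h_anti stable by auto
  have first: "\<theta> - \<beta> \<le> ?s / (?m choose 2)"
  proof -
    have c: "0 < real (n choose 2)" "0 < real (?m choose 2)" using n2 mN N by auto
    have "\<theta> * (n choose 2) \<le> card S * n * ?L + ?s"
      using ln_card_le_edge_ent[OF fin _ S(1) _ _ \<Omega>] large k by (simp add: h_def)
    moreover have "card S * n * ?L \<le> \<beta> * (n choose 2)"
    proof -
      have "real (card S) * ?L \<le> 4 * K * N * ?L / \<beta> * ?L"
        using cS L by (intro mult_right_mono) auto
      also have "\<dots> \<le> \<beta> * ((real n - 1) / 2)"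
        using n(2) \<beta> n2 K N by (simp add: field_simps power2_eq_square of_nat_diff)
      finally have "real (card S) * ?L * n \<le> \<beta> * ((real n - 1) / 2) * n"
        by (intro mult_right_mono) auto
      then show ?thesis by (simp add: real_choose_two algebra_simps)
    qed
    ultimately have gain: "(\<theta> - \<beta>) * (n choose 2) \<le> ?s" by (simp add: algebra_simps)
    have "?m choose 2 \<le> n choose 2"
      using card_mono[OF _ nsets_mono[OF Diff_subset[of ?V S], of 2]] by (simp add: card_nsets)
    then have "(\<theta> - \<beta>) * (?m choose 2) \<le> (\<theta> - \<beta>) * (n choose 2)"
      using \<beta> by (intro mult_left_mono) auto
    with gain show ?thesis using c by (simp add: pos_le_divide_eq)
  qed
  have second: "K * \<eta> * N / ((?m - (N - 2)) choose 2) \<le> \<beta>"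
  proof -
    let ?r = "?m - (N - 2)"
    have r: "n / 2 + 1 \<le> real ?r" using half N by (simp add: of_nat_diff)
    have "(real n)\<^sup>2 / 8 \<le> (n / 2 + 1) * (n / 2) / 2" by (simp add: power2_eq_square field_simps)
    also have "\<dots> \<le> real ?r * (real ?r - 1) / 2"
      using r by (intro divide_right_mono mult_mono) auto
    finally have r2: "(real n)\<^sup>2 / 8 \<le> real (?r choose 2)" by (simp add: real_choose_two)
    have "0 < (real n)\<^sup>2 / 8" using n2 by simp
    then have pos: "0 < real (?r choose 2)" using r2 by linarith
    have "K * \<eta> * N = \<beta> * ((real n)\<^sup>2 / 8)" using K N by (simp add: \<eta>_def)
    also have "\<dots> \<le> \<beta> * real (?r choose 2)" using \<beta> r2 by (intro mult_left_mono) auto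
    finally show ?thesis using pos by (simp only: pos_divide_le_eq)
  qed
  have AV: "A \<subseteq> ?V" "card A = N" "finite A" using A by (auto simp: nsets_def)
  have cardE: "card (nsets A 2) = N choose 2" using AV by (simp add: card_nsets)
  obtain C where C: "C \<subseteq> \<Omega>" "C \<noteq> {}" and CC:
    "(\<Sum>e\<in>nsets A 2. h e S) - K * (\<Sum>e\<in>nsets A 2. h e S - h e (S \<union> (A - e))) \<le>
     (\<Sum>e\<in>nsets A 2. ent C (\<lambda>c. c e)) -
       K * ((\<Sum>e\<in>nsets A 2. ent C (\<lambda>c. c e)) - joint_ent C (nsets A 2))"
    unfolding h_def using exists_good_cell[OF fin _ AV(1), of K S] K by auto
  let ?Q = "\<Sum>e\<in>nsets A 2. ent C (\<lambda>c. c e)"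
  let ?F = "?Q - joint_ent C (nsets A 2)"
  have finC: "finite C" using C fin finite_subset by blast
  have valsC: "\<forall>c\<in>C. \<forall>e\<in>nsets A 2. c e \<in> {1..k}"
    using vals C nsets_mono[OF AV(1)] by blast
  have "?q * (\<theta> - \<beta> - \<beta>) \<le> ?q * (?s / (?m choose 2) - K * \<eta> * N / ((?m - (N - 2)) choose 2))"
    using first second by (intro mult_left_mono) auto
  then have Q: "?q * (\<theta> - 2 * \<beta>) \<le> ?Q - K * ?F" using good CC by simp
  have F: "0 \<le> ?F"
    using ent_tuple_le[OF finC C(2), of "nsets A 2" "{}" "\<lambda>e c. c e"] AV
    by (simp add: joint_ent_def)
  have "?Q \<le> card (nsets A 2) * ?L"
    using ent_le_ln_card[OF finC C(2), of "{1..k}"] valsC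
    by (intro sum_bounded_above) (auto simp: image_subset_iff)
  moreover have "0 \<le> ?q * (\<theta> - 2 * \<beta>)" using \<beta> by simp
  \<comment> \<open>As \<open>?Q - K * ?F\<close> is nonnegative, \<open>K * ?F\<close> is at most
    the trivial bound on \<open>?Q\<close>, and \<open>K\<close> was chosen large enough to turn
    this into near independence.\<close>
  ultimately have "K * ?F < K * \<delta> ^ (N choose 2)" using Q K(2) unfolding cardE by linarith
  then have indep: "?F < \<delta> ^ card (nsets A 2)" using K(1) unfolding cardE by simp
  obtain t where t: "\<And>e. e \<in> nsets A 2 \<Longrightarrow> t e \<subseteq> {1..k} \<and> t e \<noteq> {}"
    "\<And>x. x \<in> (\<Pi>\<^sub>E e\<in>nsets A 2. t e) \<Longrightarrow> \<exists>c\<in>C. \<forall>e\<in>nsets A 2. c e = x e"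
    "?Q \<le> (\<Sum>e\<in>nsets A 2. ln (card (t e))) + card (nsets A 2) * (3 * k * sqrt \<delta>)"
    by (rule template_of_nearly_independent[where E = "nsets A 2", OF finC C(2)
          finite_imp_finite_nsets[OF AV(3)] valsC \<delta> indep]) (rule that)
  show thesis
  proof
    show "A \<in> nsets ?V N" using AV by (simp add: nsets_def)
    show "\<exists>c\<in>\<Omega>. \<forall>e\<in>nsets A 2. c e = x e" if "x \<in> (\<Pi>\<^sub>E e\<in>nsets A 2. t e)" for x
      using t(2)[OF that] C by blast
    have "0 \<le> K * ?F" using F K by simp
    then show "?q * (\<theta> - 2 * \<beta> - 3 * k * sqrt \<delta>) \<le> (\<Sum>e\<in>nsets A 2. ln (card (t e)))"
      using Q t(3)[unfolded cardE] by (simp add: algebra_simps)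
  qed (use t in blast)
qed

text \<open>Fix \<open>N\<close> whose extremal density is within \<open>\<epsilon> / 4\<close> of
  the limit. If \<open>P n\<close> were too large, the template obtained on some
  \<open>N\<close>-set would have entropy density at least
  \<open>entropy_density k P + 3 * \<epsilon> / 8\<close>, exceeding the extremal value.\<close>

lemma eventually_card_le:
  fixes \<epsilon> :: real
  assumes k: "2 \<le> k" and P: "order_hereditary k P" "\<And>n. P n \<noteq> {}" and \<epsilon>: "0 < \<epsilon>"
  shows "\<exists>n0. \<forall>n\<ge>n0. card (P n) \<le> real k powr ((entropy_density k P + \<epsilon>) * (n choose 2))"
proof -
  let ?\<pi> = "entropy_density k P" and ?L = "ln (real k)"
  have L: "0 < ?L" using k by simp
  have \<pi>: "0 \<le> ?\<pi>"
    using extremal_density_tendsto(1)[OF k P] extremal_entropy_nonneg[OF k P(1) P(2)]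
    by (intro LIMSEQ_le_const) auto
  have "\<forall>\<^sub>F N in sequentially. extremal_entropy k N P / (N choose 2) < ?\<pi> + \<epsilon> / 4"
    using \<epsilon> by (intro order_tendstoD[OF extremal_density_tendsto(1)[OF k P]]) simp
  then obtain N where N: "2 \<le> N" "extremal_entropy k N P / (N choose 2) < ?\<pi> + \<epsilon> / 4"
    unfolding eventually_sequentially by (meson nat_le_linear)
  let ?q = "real (N choose 2)"
  have q: "0 < ?q" using N by simp
  have ex: "extremal_entropy k N P < (?\<pi> + \<epsilon> / 4) * ?q" using N q by (simp add: pos_divide_less_eq)
  \<comment> \<open>In units of \<open>ln k\<close>, \<open>2 * \<beta>\<close> is
    \<open>\<epsilon> / 2\<close> and the rare colours cost at most \<open>\<epsilon> / 8\<close>.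
    The bound \<open>1 / (2 * k)\<close> gives \<open>\<delta> * k < 1\<close>, and the summand 1 in
    \<open>K\<close> makes its inequality strict.\<close>
  define \<beta> where "\<beta> = \<epsilon> * ?L / 4"
  define \<delta> where "\<delta> = min (1 / (2 * k)) ((\<epsilon> * ?L / (24 * k))\<^sup>2)"
  define K where "K = ?q * ?L / \<delta> ^ (N choose 2) + 1"
  have \<beta>: "0 < \<beta>" using \<epsilon> L by (simp add: \<beta>_def)
  have \<delta>0: "0 < \<delta>" using \<epsilon> L k by (simp add: \<delta>_def)
  have "\<delta> * k \<le> 1 / (2 * k) * k" by (intro mult_right_mono) (auto simp: \<delta>_def)
  then have \<delta>1: "\<delta> * k < 1" using k by simp
  have "sqrt \<delta> \<le> sqrt ((\<epsilon> * ?L / (24 * k))\<^sup>2)"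
    unfolding \<delta>_def by (intro real_sqrt_le_mono min.cobounded2)
  also have "\<dots> = \<epsilon> * ?L / (24 * k)" using \<epsilon> L by simp
  finally have \<delta>2: "3 * k * sqrt \<delta> \<le> \<epsilon> * ?L / 8" using k by (simp add: field_simps)
  have K: "0 < K" "?q * ?L < K * \<delta> ^ (N choose 2)"
    using \<delta>0 L q by (auto simp: K_def field_simps add_pos_nonneg)
  \<comment> \<open>The sum of the ceilings dominates each of them; the final 1 pays for
    \<open>n - 1\<close> in the second condition.\<close>
  define n0 where "n0 = nat \<lceil>2 * (8 * K * N * ?L / \<beta> + N + 1)\<rceil> + nat \<lceil>8 * K * N * ?L\<^sup>2 / \<beta>\<^sup>2\<rceil> + 1"
  have "card (P n) \<le> real k powr ((?\<pi> + \<epsilon>) * (n choose 2))" if n: "n0 \<le> n" for n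
  proof (rule ccontr)
    have \<Omega>: "P n \<subseteq> nsets {1..n} 2 \<rightarrow>\<^sub>E {1..k}"
      using P(1) by (auto simp: order_hereditary_def colourings_def)
    then have fin: "finite (P n)" by (rule finite_subset) (auto intro: finite_PiE)
    assume "\<not> card (P n) \<le> real k powr ((?\<pi> + \<epsilon>) * (n choose 2))"
    then have "ln (real k powr ((?\<pi> + \<epsilon>) * (n choose 2))) \<le> ln (card (P n))"
      using k fin P(2)[of n] by (subst ln_le_cancel_iff) (auto simp: card_gt_0_iff)
    then have large: "(?\<pi> + \<epsilon>) * ?L * (n choose 2) \<le> ln (card (P n))"
      using k by (simp add: ln_powr mult_ac)
    have "n0 \<le> real n" using n by simp
    then have n12: "2 * (8 * K * N * ?L / \<beta> + N + 1) \<le> n" "8 * K * N * ?L\<^sup>2 / \<beta>\<^sup>2 \<le> n - 1"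
      unfolding n0_def by linarith+
    have "2 * \<beta> \<le> (?\<pi> + \<epsilon>) * ?L" using \<epsilon> L \<pi> by (simp add: \<beta>_def algebra_simps)
    then obtain A t where A: "A \<in> nsets {1..n} N"
      and t: "\<And>e. e \<in> nsets A 2 \<Longrightarrow> t e \<subseteq> {1..k} \<and> t e \<noteq> {}"
        "\<And>x. x \<in> (\<Pi>\<^sub>E e\<in>nsets A 2. t e) \<Longrightarrow> \<exists>c\<in>P n. \<forall>e\<in>nsets A 2. c e = x e"
      and sum: "?q * ((?\<pi> + \<epsilon>) * ?L - 2 * \<beta> - 3 * k * sqrt \<delta>) \<le> (\<Sum>e\<in>nsets A 2. ln (card (t e)))"
      using template_of_large_entropy[OF fin P(2) \<Omega> k large N(1) \<beta> _ \<delta>0 \<delta>1 K n12] by blast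
    have A': "A \<subseteq> {1..n}" "card A = N" using A by (auto simp: nsets_def)
    \<comment> \<open>Passage from natural logarithms, used for \<open>ent\<close>, to base
      \<open>k\<close>, used for \<open>entropy\<close>.\<close>
    have "(\<Sum>e\<in>nsets A 2. ln (card (t e))) = ?L * (\<Sum>e\<in>nsets A 2. log k (card (t e)))"
      using L by (simp add: log_def sum_distrib_left)
    also have "\<dots> \<le> ?L * extremal_entropy k (card A) P"
      using L sum_log_le_extremal_entropy[OF P(1) A'(1) t] by (intro mult_left_mono) auto
    also have "\<dots> < ?L * ((?\<pi> + \<epsilon> / 4) * ?q)" using L ex A' by simp
    also have "\<dots> = ?q * ((?\<pi> + \<epsilon> / 4) * ?L)" by simp
    also have "\<dots> \<le> ?q * ((?\<pi> + \<epsilon>) * ?L - 2 * \<beta> - 3 * k * sqrt \<delta>)"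
      using q \<delta>2 mult_pos_pos[OF \<epsilon> L] by (intro mult_left_mono) (auto simp: \<beta>_def algebra_simps)
    finally show False using sum by simp
  qed
  then show ?thesis by blast
qed

theorem corollary2p15:
  fixes k :: nat
    and P :: "nat \<Rightarrow> (nat set \<Rightarrow> nat) set"
    and \<epsilon> :: real
  assumes "k \<ge> 2"
    and "order_hereditary k P"
    and "\<And>n. P n \<noteq> {}"
    and "\<epsilon> > 0"
  shows "\<exists>n0::nat. \<forall>n \<ge> n0.
           real k powr (entropy_density k P * real (n choose 2)) \<le> real (card (P n)) \<and>
           real (card (P n)) \<le>
             real k powr (entropy_density k P * real (n choose 2) + \<epsilon> * real (n choose 2))"
proof -
  obtain n1 where n1: "\<And>n. n1 \<le> n \<Longrightarrow>
      card (P n) \<le> real k powr ((entropy_density k P + \<epsilon>) * (n choose 2))"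
    using eventually_card_le[OF assms] by blast
  have "real k powr (entropy_density k P * real (n choose 2)) \<le> card (P n)" if "2 \<le> n" for n
  proof -
    have "entropy_density k P * real (n choose 2) \<le> extremal_entropy k n P"
      using extremal_density_tendsto(2)[OF assms(1-3) that] that by (simp add: pos_le_divide_eq)
    then have "real k powr (entropy_density k P * real (n choose 2)) \<le> real k powr extremal_entropy k n P"
      using assms(1) by (intro powr_mono) auto
    then show ?thesis using powr_extremal_entropy_le_card[OF assms(1-3), of n] by linarith
  qed
  then show ?thesis
    using n1 by (intro exI[of _ "max n1 2"]) (simp add: algebra_simps)
qed

end
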